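(* Let $N\in\mathbb{N}$, $N\ge2$, let $\mathcal{S}=(\sigma(0),\sigma(1),\ldots)\subseteq\mathbb{N}_0$ be a list with $\sigma(0)=0$ such that $m_i:=\sigma(i+1)-\sigma(i)\in\{1,2,\ldots,N-1\}$ for all $i\in\mathbb{N}_0$, let $x_0\in\mathbb{X}$, and let $(x_i)_{i\in\mathbb{N}_0}$, $x_{i+1}=x_{u_N}(m_i;x_i)$, be the closed loop trajectory at the update instants generated by $\mu_N^{\mathcal{S}}$. Let $\overline{\alpha}\in(0,1]$ and $$\rho_i:=V_N(x_i)-V_N(x_{u_N}(m_i;x_i))-\overline{\alpha}\sum_{k=0}^{m_i-1}\ell\big(x_{u_N}(k;x_i),u_N(k;x_i)\big),\qquad s_n:=\sum_{i=0}^n\rho_i .$$ Let $s_n\ge0$ hold for some $n\in\mathbb{N}_0$. Then the closed loop trajectory satisfies the following relaxed Lyapunov inequality at $x_{n+1}$: $$V_N(x_{n+1})+\overline{\alpha}\sum_{i=0}^n\sum_{k=0}^{m_i-1}\ell\big(x_{u_N}(k;x_i),u_N(k;x_i)\big)\ \le\ V_N(x_0).$$ If $\lim_{n\to\infty}s_n\ge0$ holds, then $$\overline{\alpha}\,V_\infty(x_0)\ \le\ \overline{\alpha}\,V_\infty^{\mu_N^{\mathcal{S}}}(x_0)\ \le\ V_N(x_0)\ \le\ V_\infty(x_0).$$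
   Context: Let $X,U$ be Banach spaces with metrics $d_X,d_U$, let $\mathbb{X}\subset X$, $\mathbb{U}\subset U$ (state and control constraints), and let $f:X\times U\to X$ define the system $x(n+1)=f(x(n),u(n))$, $x(0)=x_0$. For a control sequence $u$, $x_u(\cdot;x_0)$ denotes the resulting trajectory with $x_u(0;x_0)=x_0$. Let $x^\star\in\mathbb{X}$ and $u^\star\in\mathbb{U}$ with $f(x^\star,u^\star)=x^\star$. The stage cost $\ell:X\times U\to[0,\infty)$ is continuous, $\ell(x^\star,u^\star)=0$, and $\ell(x,u)>0$ for all $u\in U$ and all $x\ne x^\star$. Viability is assumed: for every $x\in\mathbb{X}$ there is $u_x\in\mathbb{U}$ with $f(x,u_x)\in\mathbb{X}$. Infinite horizon: $J_\infty(x_0,u)=\sum_{n=0}^\infty\ell(x_u(n;x_0),u(n))$ and $V_\infty(x_0)=\inf J_\infty(x_0,u)$ over all $u:\mathbb{N}_0\to\mathbb{U}$ with $x_u(n;x_0)\in\mathbb{X}$ for all $n\in\mathbb{N}$ (values in $[0,\infty]$). Finite horizon: $J_N(x_0,u)=\sum_{k=0}^{N-1}\ell(x_u(k;x_0),u(k))$, and $V_N(x_0)$ is the minimum of $J_N(x_0,u)$ over all $u\in\mathbb{U}^N$ with $x_u(k;x_0)\in\mathbb{X}$ for $k=1,\ldots,N$. Minima are assumed to be attained. $u_N(\cdot;x_0)$ denotes a (chosen) minimizer, and $x_{u_N}(\cdot;x_0)$ the corresponding open loop trajectory. Multistep MPC: at each update instant $\sigma(i)$, in state $x_i$, the first $m_i$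 elements of $u_N(\cdot;x_i)$ are applied, i.e. $\mu_N^{\mathcal{S}}(k;x_i)=u_N(k;x_i)$ for $k=0,\ldots,m_i-1$. The closed loop cost is $V_\infty^{\mu_N^{\mathcal{S}}}(x_0)=\sum_{i=0}^\infty\sum_{k=0}^{m_i-1}\ell(x_{u_N}(k;x_i),\mu_N^{\mathcal{S}}(k;x_i))$. *)

theory Defs
  imports "HOL-Analysis.Analysis"
begin

primrec trajectory :: "('x \<Rightarrow> 'u \<Rightarrow> 'x) \<Rightarrow> (nat \<Rightarrow> 'u) \<Rightarrow> 'x \<Rightarrow> nat \<Rightarrow> 'x" where
  "trajectory f u x0 0 = x0"
| "trajectory f u x0 (Suc n) = f (trajectory f u x0 n) (u n)"

definition inf_admissible ::
    "('x \<Rightarrow> 'u \<Rightarrow> 'x) \<Rightarrow> 'x set \<Rightarrow> 'u set \<Rightarrow> 'x \<Rightarrow> (nat \<Rightarrow> 'u) set" where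
  "inf_admissible f XX UU x0 =
     {u. (\<forall>n. u n \<in> UU) \<and> (\<forall>n\<ge>1. trajectory f u x0 n \<in> XX)}"

definition inf_cost ::
    "('x \<Rightarrow> 'u \<Rightarrow> 'x) \<Rightarrow> ('x \<Rightarrow> 'u \<Rightarrow> real) \<Rightarrow> 'x \<Rightarrow> (nat \<Rightarrow> 'u) \<Rightarrow> ennreal" where
  "inf_cost f l x0 u = (\<Sum>n. ennreal (l (trajectory f u x0 n) (u n)))"

text \<open>The infimum is taken in \<^typ>\<open>ennreal\<close>, so it is infinite if there is no admissible control.\<close>

definition inf_value ::
    "('x \<Rightarrow> 'u \<Rightarrow> 'x) \<Rightarrow> ('x \<Rightarrow> 'u \<Rightarrow> real) \<Rightarrow> 'x set \<Rightarrow> 'u set \<Rightarrow> 'x \<Rightarrow> ennreal" where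
  "inf_value f l XX UU x0 = (INF u\<in>inf_admissible f XX UU x0. inf_cost f l x0 u)"

text \<open>Elements of \<open>UU\<^sup>N\<close> are extensional functions on \<open>{..<N}\<close>; the state constraint
  includes the terminal time \<open>N\<close>.\<close>

definition fin_admissible ::
    "('x \<Rightarrow> 'u \<Rightarrow> 'x) \<Rightarrow> 'x set \<Rightarrow> 'u set \<Rightarrow> nat \<Rightarrow> 'x \<Rightarrow> (nat \<Rightarrow> 'u) set" where
  "fin_admissible f XX UU N x0 =
     {u \<in> {..<N} \<rightarrow>\<^sub>E UU. \<forall>k\<in>{1..N}. trajectory f u x0 k \<in> XX}"

definition fin_cost ::
    "('x \<Rightarrow> 'u \<Rightarrow> 'x) \<Rightarrow> ('x \<Rightarrow> 'u \<Rightarrow> real) \<Rightarrow> nat \<Rightarrow> 'x \<Rightarrow> (nat \<Rightarrow> 'u) \<Rightarrow> real" where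
  "fin_cost f l N x0 u = (\<Sum>k<N. l (trajectory f u x0 k) (u k))"

text \<open>Real infimum; it is the minimum whenever a minimizer exists, which is a hypothesis
  wherever this value is used.\<close>

definition fin_value ::
    "('x \<Rightarrow> 'u \<Rightarrow> 'x) \<Rightarrow> ('x \<Rightarrow> 'u \<Rightarrow> real) \<Rightarrow> 'x set \<Rightarrow> 'u set \<Rightarrow> nat \<Rightarrow> 'x \<Rightarrow> real" where
  "fin_value f l XX UU N x0 = (INF u\<in>fin_admissible f XX UU N x0. fin_cost f l N x0 u)"

text \<open>The multistep feedback \<open>\<mu> k x\<close> is only ever evaluated at times \<open>k < m i\<close> and at
  the states \<open>x\<close> of the update instants.\<close>

definition mpc_feedback :: "('x \<Rightarrow> nat \<Rightarrow> 'u) \<Rightarrow> nat \<Rightarrow> 'x \<Rightarrow> 'u" where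
  "mpc_feedback uN k x = uN x k"

primrec update_state ::
    "('x \<Rightarrow> 'u \<Rightarrow> 'x) \<Rightarrow> ('x \<Rightarrow> nat \<Rightarrow> 'u) \<Rightarrow> (nat \<Rightarrow> nat) \<Rightarrow> 'x \<Rightarrow> nat \<Rightarrow> 'x" where
  "update_state f uN m x0 0 = x0"
| "update_state f uN m x0 (Suc i) =
     trajectory f (uN (update_state f uN m x0 i)) (update_state f uN m x0 i) (m i)"

definition closed_loop_cost ::
    "('x \<Rightarrow> 'u \<Rightarrow> 'x) \<Rightarrow> ('x \<Rightarrow> 'u \<Rightarrow> real) \<Rightarrow> ('x \<Rightarrow> nat \<Rightarrow> 'u) \<Rightarrow> (nat \<Rightarrow> nat) \<Rightarrow> 'x \<Rightarrow> ennreal" where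
  "closed_loop_cost f l uN m x0 =
     (\<Sum>i. \<Sum>k<m i. ennreal
        (let xi = update_state f uN m x0 i
         in l (trajectory f (uN xi) xi k) (mpc_feedback uN k xi)))"

end

theory Submission
  imports Defs
begin

text \<open>
  Along the closed loop the state after the \<open>i\<close>-th block is the next update state, so the
  differences of the finite horizon values \<open>V\<^sub>N (x i) - V\<^sub>N (x (i + 1))\<close> telescope and
  \<open>s n = V\<^sub>N x0 - V\<^sub>N (x (n + 1)) - \<alpha> * C n\<close>, where \<open>C n\<close> is the closed loop cost of the
  first \<open>n + 1\<close> blocks. The relaxed Lyapunov inequality is therefore the condition
  \<open>0 \<le> s n\<close> rewritten. Since \<open>V\<^sub>N \<ge> 0\<close>, the identity also yields \<open>\<alpha> * C n \<le> V\<^sub>N x0 - s n\<close>,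
  and letting \<open>n\<close> tend to infinity bounds the closed loop cost when \<open>lim s \<ge> 0\<close>.

  The two outer inequalities compare optimal values. Truncating an admissible control on the
  infinite horizon gives an admissible one on the finite horizon, and drops only nonnegative
  stage costs (\<open>fin_value_le_inf_value\<close>). Conversely, the blocks applied by the closed loop
  can be glued to one control sequence on the infinite horizon that is admissible and whose
  cost is at most the closed loop cost (\<open>inf_value_le_block_cost\<close>).
\<close>

section \<open>Gluing blocks of a partitioned time axis\<close>

lemma block_decomposition:
  fixes \<sigma> :: "nat \<Rightarrow> nat"
  assumes "strict_mono \<sigma>" and "\<sigma> 0 = 0"
  obtains i k where "n = \<sigma> i + k" and "k < \<sigma> (Suc i) - \<sigma> i"
proof -
  have "\<exists>i k. n = \<sigma> i + k \<and> k < \<sigma> (Suc i) - \<sigma> i"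
  proof (induction n)
    case 0
    have "\<sigma> 0 < \<sigma> (Suc 0)"
      using assms(1) by (simp add: strict_mono_less)
    then show ?case
      using assms(2) by (intro exI[of _ 0]) simp
  next
    case (Suc n)
    then obtain i k where ik: "n = \<sigma> i + k" "k < \<sigma> (Suc i) - \<sigma> i"
      by blast
    show ?case
    proof (cases "Suc k < \<sigma> (Suc i) - \<sigma> i")
      case True
      then show ?thesis
        using ik(1) by (intro exI[of _ i] exI[of _ "Suc k"]) simp
    next
      case False
      have "\<sigma> (Suc i) < \<sigma> (Suc (Suc i))"
        using assms(1) by (simp add: strict_mono_less)
      then show ?thesis
        using ik False by (intro exI[of _ "Suc i"] exI[of _ 0]) simp
    qed
  qed
  then show ?thesis
    using that by blast
qed

text \<open>
  The block containing time \<open>n\<close> is the first one that ends after \<open>n\<close>.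
\<close>

lemma glue_blocks:
  fixes \<sigma> :: "nat \<Rightarrow> nat" and v :: "nat \<Rightarrow> nat \<Rightarrow> 'a"
  assumes "strict_mono \<sigma>"
  obtains u where "\<And>i k. k < \<sigma> (Suc i) - \<sigma> i \<Longrightarrow> u (\<sigma> i + k) = v i k"
proof
  fix i k
  assume k: "k < \<sigma> (Suc i) - \<sigma> i"
  have "(LEAST j. \<sigma> i + k < \<sigma> (Suc j)) = i"
  proof (rule Least_equality)
    show "\<sigma> i + k < \<sigma> (Suc i)"
      using k by simp
    fix j
    assume "\<sigma> i + k < \<sigma> (Suc j)"
    then have "\<sigma> i < \<sigma> (Suc j)"
      by simp
    then show "i \<le> j"
      using assms by (simp add: strict_mono_less)
  qed
  then show "(\<lambda>n. let i = LEAST j. n < \<sigma> (Suc j) in v i (n - \<sigma> i)) (\<sigma> i + k) = v i k"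
    by simp
qed

lemma sum_lessThan_add:
  fixes g :: "nat \<Rightarrow> 'a::comm_monoid_add"
  shows "sum g {..<a + b} = sum g {..<a} + (\<Sum>k<b. g (a + k))"
  by (induction b) (simp_all add: add.assoc)

lemma sum_lessThan_blocks:
  fixes g :: "nat \<Rightarrow> 'a::comm_monoid_add"
  assumes "mono \<sigma>" and "\<sigma> 0 = 0"
  shows "sum g {..<\<sigma> K} = (\<Sum>i<K. \<Sum>k<\<sigma> (Suc i) - \<sigma> i. g (\<sigma> i + k))"
proof (induction K)
  case (Suc K)
  have "\<sigma> (Suc K) = \<sigma> K + (\<sigma> (Suc K) - \<sigma> K)"
    using monoD[OF assms(1), of K "Suc K"] by simp
  then have "sum g {..<\<sigma> (Suc K)}
      = sum g {..<\<sigma> K} + (\<Sum>k<\<sigma> (Suc K) - \<sigma> K. g (\<sigma> K + k))"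
    by (metis sum_lessThan_add)
  then show ?case
    using Suc by simp
qed (simp add: assms(2))

section \<open>Trajectories and optimal values\<close>

lemma trajectory_cong:
  assumes "\<And>k. k < n \<Longrightarrow> u k = v k"
  shows "trajectory f u x0 n = trajectory f v x0 n"
  using assms by (induction n) auto

lemma trajectory_add:
  "trajectory f u x0 (n + k) = trajectory f (\<lambda>j. u (n + j)) (trajectory f u x0 n) k"
  by (induction k) auto

lemma bdd_below_fin_cost:
  assumes "\<And>y v. 0 \<le> l y v"
  shows "bdd_below (fin_cost f l N x0 ` A)"
  using assms by (intro bdd_belowI2[of _ 0]) (simp add: fin_cost_def sum_nonneg)

lemma fin_value_nonneg:
  assumes "\<And>y v. 0 \<le> l y v" and "fin_admissible f XX UU N x0 \<noteq> {}"
  shows "0 \<le> fin_value f l XX UU N x0"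
  using assms by (auto simp: fin_value_def fin_cost_def intro!: cINF_greatest sum_nonneg)

text \<open>
  Dropping the tail of an infinite horizon control keeps the constraints and discards only
  nonnegative costs.
\<close>

lemma fin_value_le_inf_value:
  assumes nonneg: "\<And>y v. 0 \<le> l y v"
  shows "ennreal (fin_value f l XX UU N x0) \<le> inf_value f l XX UU x0"
  unfolding inf_value_def
proof (rule INF_greatest)
  fix u
  assume u: "u \<in> inf_admissible f XX UU x0"
  let ?u = "restrict u {..<N}"
  have traj: "trajectory f ?u x0 k = trajectory f u x0 k" if "k \<le> N" for k
    using that by (intro trajectory_cong) auto
  have "?u \<in> fin_admissible f XX UU N x0"
    using u traj by (auto simp: fin_admissible_def inf_admissible_def)
  then have "fin_value f l XX UU N x0 \<le> fin_cost f l N x0 ?u"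
    unfolding fin_value_def by (intro cINF_lower bdd_below_fin_cost nonneg)
  also have "\<dots> = (\<Sum>k<N. l (trajectory f u x0 k) (u k))"
    by (simp add: fin_cost_def traj)
  finally have "ennreal (fin_value f l XX UU N x0)
      \<le> (\<Sum>k<N. ennreal (l (trajectory f u x0 k) (u k)))"
    using nonneg by (simp add: sum_ennreal ennreal_leI)
  also have "\<dots> \<le> inf_cost f l x0 u"
    unfolding inf_cost_def by (intro sum_le_suminf) auto
  finally show "ennreal (fin_value f l XX UU N x0) \<le> inf_cost f l x0 u" .
qed

text \<open>
  The controls \<open>v i\<close>, each applied on its block, form one control sequence whose trajectory runs
  through the given block states \<open>x i\<close>. As every time lies in some block, the constraints
  on the blocks make the glued control admissible, and every finite horizon is covered by
  finitely many blocks, so that its cost is bounded by the sum of the block costs.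
\<close>

lemma inf_value_le_block_cost:
  fixes \<sigma> :: "nat \<Rightarrow> nat" and v :: "nat \<Rightarrow> nat \<Rightarrow> 'u" and x :: "nat \<Rightarrow> 'x"
  assumes mono: "strict_mono \<sigma>" and zero: "\<sigma> 0 = 0"
    and step: "\<And>i. x (Suc i) = trajectory f (v i) (x i) (\<sigma> (Suc i) - \<sigma> i)"
    and control: "\<And>i k. k < \<sigma> (Suc i) - \<sigma> i \<Longrightarrow> v i k \<in> UU"
    and state: "\<And>i k. k < \<sigma> (Suc i) - \<sigma> i \<Longrightarrow> trajectory f (v i) (x i) k \<in> XX"
  shows "inf_value f l XX UU (x 0)
    \<le> (\<Sum>i. \<Sum>k<\<sigma> (Suc i) - \<sigma> i. ennreal (l (trajectory f (v i) (x i) k) (v i k)))"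
proof -
  let ?m = "\<lambda>i. \<sigma> (Suc i) - \<sigma> i"
  obtain u where u: "\<And>i k. k < ?m i \<Longrightarrow> u (\<sigma> i + k) = v i k"
    using glue_blocks[OF mono] by metis
  have block: "trajectory f u (x 0) (\<sigma> i + k) = trajectory f (v i) (x i) k"
    if "trajectory f u (x 0) (\<sigma> i) = x i" "k \<le> ?m i" for i k
    using that by (simp add: trajectory_add) (intro trajectory_cong u, simp)
  have start: "trajectory f u (x 0) (\<sigma> i) = x i" for i
  proof (induction i)
    case (Suc i)
    have "\<sigma> (Suc i) = \<sigma> i + ?m i"
      using strict_mono_less[OF mono, of i "Suc i"] by simp
    then show ?case
      using block[OF Suc, of "?m i"] by (simp add: step)
  qed (simp add: zero)
  note traj = block[OF start]
  have "u \<in> inf_admissible f XX UU (x 0)"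
    unfolding inf_admissible_def
  proof (intro CollectI conjI allI impI)
    fix n
    obtain i k where "n = \<sigma> i + k" "k < ?m i"
      using block_decomposition[OF mono zero] by blast
    then show "u n \<in> UU" and "trajectory f u (x 0) n \<in> XX"
      using u traj control state by simp_all
  qed
  then have "inf_value f l XX UU (x 0) \<le> inf_cost f l (x 0) u"
    unfolding inf_value_def by (rule INF_lower)
  also have "\<dots> \<le> (\<Sum>i. \<Sum>k<?m i. ennreal (l (trajectory f (v i) (x i) k) (v i k)))"
    unfolding inf_cost_def
  proof (rule suminf_le_const)
    fix K
    let ?g = "\<lambda>n. ennreal (l (trajectory f u (x 0) n) (u n))"
    have "sum ?g {..<K} \<le> sum ?g {..<\<sigma> K}"
      using strict_mono_imp_increasing[OF mono] by (intro sum_mono2) auto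
    also have "\<dots> = (\<Sum>i<K. \<Sum>k<?m i. ?g (\<sigma> i + k))"
      using mono zero by (intro sum_lessThan_blocks strict_mono_mono)
    also have "\<dots> = (\<Sum>i<K. \<Sum>k<?m i. ennreal (l (trajectory f (v i) (x i) k) (v i k)))"
      using u traj by (intro sum.cong) simp_all
    also have "\<dots> \<le> (\<Sum>i. \<Sum>k<?m i. ennreal (l (trajectory f (v i) (x i) k) (v i k)))"
      by (intro sum_le_suminf) auto
    finally show "sum ?g {..<K} \<le> \<dots>" .
  qed simp
  finally show ?thesis .
qed

section \<open>Performance of the closed loop\<close>

theorem corollary6p2:
  fixes d_X :: "'x::banach \<Rightarrow> 'x \<Rightarrow> real"
    and d_U :: "'u::banach \<Rightarrow> 'u \<Rightarrow> real"
    and f :: "'x \<Rightarrow> 'u \<Rightarrow> 'x"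
    and l :: "'x \<Rightarrow> 'u \<Rightarrow> real"
    and XX :: "'x set" and UU :: "'u set"
    and xstar :: 'x and ustar :: 'u
    and N :: nat
    and uN :: "'x \<Rightarrow> nat \<Rightarrow> 'u"
    and \<sigma> m :: "nat \<Rightarrow> nat"
    and x0 :: 'x and x :: "nat \<Rightarrow> 'x"
    and \<alpha> :: real
    and \<rho> s :: "nat \<Rightarrow> real"
  assumes "Metric_space UNIV d_X" and "Metric_space UNIV d_U"
    and "xstar \<in> XX" and "ustar \<in> UU" and "f xstar ustar = xstar"
    and "\<forall>y v. 0 \<le> l y v"
    and "continuous_map
           (prod_topology (Metric_space.mtopology UNIV d_X) (Metric_space.mtopology UNIV d_U))
           euclideanreal (\<lambda>(y, v). l y v)"
    and "l xstar ustar = 0"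
    and "\<forall>v y. y \<noteq> xstar \<longrightarrow> 0 < l y v"
    and "\<forall>y\<in>XX. \<exists>v\<in>UU. f y v \<in> XX"
    and "2 \<le> N"
    and "\<forall>y\<in>XX. is_arg_min (fin_cost f l N y) (\<lambda>u. u \<in> fin_admissible f XX UU N y) (uN y)"
    and "\<sigma> 0 = 0"
    and "\<forall>i. m i = \<sigma> (i + 1) - \<sigma> i"
    and "\<forall>i. m i \<in> {1..N - 1}"
    and "x0 \<in> XX"
    and "\<forall>i. x i = update_state f uN m x0 i"
    and "0 < \<alpha>" and "\<alpha> \<le> 1"
    and "\<forall>i. \<rho> i =
           fin_value f l XX UU N (x i)
           - fin_value f l XX UU N (trajectory f (uN (x i)) (x i) (m i))
           - \<alpha> * (\<Sum>k<m i. l (trajectory f (uN (x i)) (x i) k) (uN (x i) k))"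
    and "\<forall>n. s n = (\<Sum>i\<le>n. \<rho> i)"
  shows "(\<forall>n. 0 \<le> s n \<longrightarrow>
            fin_value f l XX UU N (x (n + 1))
            + \<alpha> * (\<Sum>i\<le>n. \<Sum>k<m i. l (trajectory f (uN (x i)) (x i) k) (uN (x i) k))
            \<le> fin_value f l XX UU N x0)
       \<and> (convergent s \<and> 0 \<le> lim s \<longrightarrow>
            ennreal \<alpha> * inf_value f l XX UU x0 \<le> ennreal \<alpha> * closed_loop_cost f l uN m x0
          \<and> ennreal \<alpha> * closed_loop_cost f l uN m x0 \<le> ennreal (fin_value f l XX UU N x0)
          \<and> ennreal (fin_value f l XX UU N x0) \<le> inf_value f l XX UU x0)"
proof -
  let ?V = "fin_value f l XX UU N"
  let ?c = "\<lambda>i. \<Sum>k<m i. l (trajectory f (uN (x i)) (x i) k) (uN (x i) k)"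
  have nonneg: "0 \<le> l y v" for y v
    using assms(6) by blast
  have adm: "uN y \<in> fin_admissible f XX UU N y" if "y \<in> XX" for y
    using assms(12) that by (auto simp: is_arg_min_def)
  have m: "m i = \<sigma> (Suc i) - \<sigma> i" "1 \<le> m i" "m i < N" for i
    using assms(11,14) assms(15)[rule_format, of i] by auto
  have mono: "strict_mono \<sigma>"
    unfolding strict_mono_Suc_iff using m(1,2) by (metis One_nat_def Suc_le_lessD zero_less_diff)
  have x: "x 0 = x0" "x (Suc i) = trajectory f (uN (x i)) (x i) (m i)" for i
    using assms(17) by simp_all
  have traj_XX: "trajectory f (uN y) y k \<in> XX" if "y \<in> XX" "k < N" for y k
    using adm[OF that(1)] that by (cases "k = 0") (auto simp: fin_admissible_def)
  have x_XX: "x i \<in> XX" for i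
    using assms(16) x traj_XX m(3) by (induction i) simp_all
  have V_nonneg: "0 \<le> ?V (x i)" for i
    using adm[OF x_XX] nonneg by (intro fin_value_nonneg) auto
  have c_nonneg: "0 \<le> ?c i" for i
    by (simp add: nonneg sum_nonneg)

  have telescope: "s n = ?V x0 - ?V (x (Suc n)) - \<alpha> * (\<Sum>i\<le>n. ?c i)" for n
  proof -
    have "s n = (\<Sum>i\<le>n. ?V (x i) - ?V (x (Suc i)) - \<alpha> * ?c i)"
      using assms(20,21) x(2) by simp
    also have "\<dots> = (\<Sum>i\<le>n. ?V (x i) - ?V (x (Suc i))) - \<alpha> * (\<Sum>i\<le>n. ?c i)"
      by (simp add: sum_subtractf sum_distrib_left)
    also have "(\<Sum>i\<le>n. ?V (x i) - ?V (x (Suc i))) = ?V x0 - ?V (x (Suc n))"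
      using sum_telescope[of "\<lambda>i. ?V (x i)" n] x(1) by simp
    finally show ?thesis .
  qed
  have lyapunov: "\<forall>n. 0 \<le> s n \<longrightarrow> ?V (x (n + 1)) + \<alpha> * (\<Sum>i\<le>n. ?c i) \<le> ?V x0"
    using telescope by simp

  have cost: "closed_loop_cost f l uN m x0
      = (\<Sum>i. \<Sum>k<m i. ennreal (l (trajectory f (uN (x i)) (x i) k) (uN (x i) k)))"
    using assms(17) by (simp add: closed_loop_cost_def mpc_feedback_def Let_def)
  have lower: "inf_value f l XX UU x0 \<le> closed_loop_cost f l uN m x0"
  proof -
    have "uN (x i) k \<in> UU" if "k < m i" for i k
      using adm[OF x_XX[of i]] that m(3)[of i] by (auto simp: fin_admissible_def)
    moreover have "trajectory f (uN (x i)) (x i) k \<in> XX" if "k < m i" for i k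
      using traj_XX[OF x_XX] that m(3)[of i] by simp
    ultimately show ?thesis
      using inf_value_le_block_cost[of \<sigma> x f "\<lambda>i. uN (x i)" UU XX l] mono assms(13) x
      by (simp add: cost m(1))
  qed

  have upper: "ennreal \<alpha> * closed_loop_cost f l uN m x0 \<le> ennreal (?V x0)"
    if "convergent s" "0 \<le> lim s"
  proof -
    have "s \<longlonglongrightarrow> lim s"
      using that(1) by (simp add: convergent_LIMSEQ_iff)
    then have lim: "(\<lambda>n. ?V x0 - s n) \<longlonglongrightarrow> ?V x0 - lim s"
      by (intro tendsto_intros)
    \<comment> \<open>The block costs are nonnegative, so the cost up to block \<open>n\<close> is bounded by
      \<open>V\<^sub>N x0 - s k\<close> for every later \<open>k\<close>, and hence by the limit over \<open>k\<close>.\<close>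
    have bound: "\<alpha> * (\<Sum>i\<le>n. ?c i) \<le> ?V x0 - lim s" for n
    proof (rule LIMSEQ_le_const[OF lim], intro exI allI impI)
      fix k
      assume "n \<le> k"
      then have "\<alpha> * (\<Sum>i\<le>n. ?c i) \<le> \<alpha> * (\<Sum>i\<le>k. ?c i)"
        using assms(18) c_nonneg by (intro mult_left_mono sum_mono2) auto
      also have "\<dots> \<le> ?V x0 - s k"
        using telescope[of k] V_nonneg[of "Suc k"] by linarith
      finally show "\<alpha> * (\<Sum>i\<le>n. ?c i) \<le> ?V x0 - s k" .
    qed
    have "ennreal \<alpha> * closed_loop_cost f l uN m x0 = (\<Sum>i. ennreal (\<alpha> * ?c i))"
      using assms(18) nonneg c_nonneg by (simp add: cost sum_ennreal ennreal_mult)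
    also have "\<dots> \<le> ennreal (?V x0)"
    proof (rule suminf_le_const)
      fix n
      have "(\<Sum>i<n. ennreal (\<alpha> * ?c i)) \<le> (\<Sum>i\<le>n. ennreal (\<alpha> * ?c i))"
        by (intro sum_mono2) auto
      also have "\<dots> = ennreal (\<alpha> * (\<Sum>i\<le>n. ?c i))"
        using assms(18) c_nonneg by (subst sum_ennreal) (simp_all flip: sum_distrib_left)
      also have "\<dots> \<le> ennreal (?V x0)"
        using bound[of n] that(2) by (intro ennreal_leI) linarith
      finally show "(\<Sum>i<n. ennreal (\<alpha> * ?c i)) \<le> ennreal (?V x0)" .
    qed simp
    finally show ?thesis .
  qed

  show ?thesis
    using lyapunov mult_left_mono[OF lower, of "ennreal \<alpha>"] upper
      fin_value_le_inf_value[of l f XX UU N x0] nonneg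
    by auto
qed

end
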